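(* For the path $P_n$ on $n \ge 2$ vertices, $\textrm{RED:LD}(P_n) = \lceil (2n+2)/3 \rceil$.
   Context: $N(v)$ denotes the open neighborhood of $v$. A set $S \subseteq V(G)$ is a locating-dominating (LD) set if for all $u,v \in V(G)-S$: $N(v)\cap S \neq \varnothing$, and if $u \ne v$ then $N(v) \cap S \neq N(u) \cap S$. A RED:LD set is an LD set $S$ such that $S-\{v\}$ is an LD set for every $v \in S$. $\textrm{RED:LD}(G)$ is the minimum cardinality of a RED:LD set of $G$. *)

theory Defs
  imports Complex_Main "HOL-Library.Extended_Nat" "Graph_Theory.Pair_Digraph"
begin

text \<open>
  A simple graph is a \<^locale>\<open>pair_graph\<close>: each edge is represented by its two opposite arcs.
\<close>

definition nbhd :: "'a pair_pre_digraph \<Rightarrow> 'a \<Rightarrow> 'a set" where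
  "nbhd G v = {u \<in> pverts G. (v, u) \<in> parcs G}"

definition LD_set :: "'a pair_pre_digraph \<Rightarrow> 'a set \<Rightarrow> bool" where
  "LD_set G S \<longleftrightarrow> S \<subseteq> pverts G \<and>
     (\<forall>u \<in> pverts G - S. \<forall>v \<in> pverts G - S.
        nbhd G v \<inter> S \<noteq> {} \<and> (u \<noteq> v \<longrightarrow> nbhd G v \<inter> S \<noteq> nbhd G u \<inter> S))"

definition RED_LD_set :: "'a pair_pre_digraph \<Rightarrow> 'a set \<Rightarrow> bool" where
  "RED_LD_set G S \<longleftrightarrow> LD_set G S \<and> (\<forall>v \<in> S. LD_set G (S - {v}))"

text \<open>
  The minimum is taken in \<^typ>\<open>enat\<close>, so that it is \<open>\<infinity>\<close> when no RED:LD set exists; an equation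
  \<open>RED_LD G = enat k\<close> therefore includes the existence of a RED:LD set of cardinality \<open>k\<close>.
\<close>
definition RED_LD :: "'a pair_pre_digraph \<Rightarrow> enat" where
  "RED_LD G = (INF S \<in> {S. RED_LD_set G S \<and> finite S}. enat (card S))"

definition path_graph :: "nat \<Rightarrow> nat pair_pre_digraph" where
  "path_graph n =
     \<lparr> pverts = {..<n},
       parcs = {(i, j). i < n \<and> j < n \<and> (j = Suc i \<or> i = Suc j)} \<rparr>"

lemma pair_graph_path_graph: "pair_graph (path_graph n)"
proof -
  have "finite {(i, j). i < n \<and> j < n \<and> (j = Suc i \<or> i = Suc j)}"
    by (rule finite_subset[of _ "{..<n} \<times> {..<n}"]) auto
  then show ?thesis
    by unfold_locales (auto simp: path_graph_def symmetric_def sym_def)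
qed

lemma RED_LD_eq_enat_iff:
  "RED_LD G = enat k \<longleftrightarrow>
     (\<exists>S. RED_LD_set G S \<and> finite S \<and> card S = k) \<and>
     (\<forall>S. RED_LD_set G S \<and> finite S \<longrightarrow> k \<le> card S)"
  (is "?L \<longleftrightarrow> ?R")
proof
  let ?A = "(\<lambda>S. enat (card S)) ` {S. RED_LD_set G S \<and> finite S}"
  assume L: ?L
  then have I: "Inf ?A = enat k" by (simp add: RED_LD_def)
  have ne: "?A \<noteq> {}"
  proof
    assume "?A = {}"
    with I show False by (simp only: Inf_enat_def) simp
  qed
  then have "\<exists>x. x \<in> ?A" by blast
  then have "(LEAST x. x \<in> ?A) \<in> ?A" by (rule LeastI_ex)
  with ne have "Inf ?A \<in> ?A" by (simp only: Inf_enat_def if_False)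
  moreover have "enat k \<le> enat (card S)" if "RED_LD_set G S" "finite S" for S
    using that I[symmetric] by (auto intro: Inf_lower)
  ultimately show ?R using I by auto
next
  assume ?R
  then show ?L unfolding RED_LD_def
    by (intro antisym INF_greatest) (auto intro: INF_lower2)
qed

end

theory Submission
  imports Defs
begin

text \<open>
  A subset of a path is a RED:LD set exactly if every vertex outside it has two neighbours in it and
  every vertex inside it has one; the separation conditions then hold automatically. So the
  complement consists of isolated vertices \<open>g\<close> with \<open>2 \<le> g \<le> n - 3\<close> at mutual distance at least \<open>3\<close>,
  of which there are at most \<open>\<lfloor>(n - 2) / 3\<rfloor>\<close>, the maximum being attained by \<open>2, 5, 8, \<dots>\<close>.
\<close>

text \<open>Deleting \<open>w\<close> must leave \<open>v\<close> dominated. Letting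
  \<open>w\<close> vary expresses the presence of two neighbours in \<open>S\<close> without
  cardinalities.\<close>

lemma RED_LD_set_imp_two_neighbours:
  assumes "RED_LD_set G S" "v \<in> pverts G" "v \<notin> S"
  shows "nbhd G v \<inter> S - {w} \<noteq> {}"
proof (cases "w \<in> S")
  case True
  with assms have "LD_set G (S - {w})" "v \<in> pverts G - (S - {w})"
    by (auto simp: RED_LD_set_def)
  then have "nbhd G v \<inter> (S - {w}) \<noteq> {}" unfolding LD_set_def by blast
  then show ?thesis by blast
next
  case False
  from assms have "nbhd G v \<inter> S \<noteq> {}" unfolding RED_LD_set_def LD_set_def by blast
  with False show ?thesis by blast
qed

lemma RED_LD_set_imp_neighbour:
  assumes "RED_LD_set G S" "v \<in> S"
  shows "nbhd G v \<inter> (S - {v}) \<noteq> {}"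
proof -
  from assms have "LD_set G (S - {v})" "v \<in> pverts G - (S - {v})"
    by (auto simp: RED_LD_set_def LD_set_def)
  then show ?thesis unfolding LD_set_def by blast
qed

lemma pverts_path_graph [simp]: "pverts (path_graph n) = {..<n}"
  by (simp add: path_graph_def)

lemma in_nbhd_path_graph_iff:
  "u \<in> nbhd (path_graph n) v \<longleftrightarrow> u < n \<and> v < n \<and> (u = Suc v \<or> v = Suc u)"
  by (auto simp: nbhd_def path_graph_def)

text \<open>Left to right is domination after a deletion; right to left needs separation as well. In
  the last clause the guard \<open>0 < v\<close> matters: since \<open>0 - 1 = 0\<close>, vertex
  \<open>0\<close> would otherwise count as its own neighbour.\<close>

lemma RED_LD_set_path_graph_iff:
  "RED_LD_set (path_graph n) S \<longleftrightarrow>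
     S \<subseteq> {..<n} \<and>
     (\<forall>v<n. v \<notin> S \<longrightarrow> 0 < v \<and> v - 1 \<in> S \<and> Suc v \<in> S) \<and>
     (\<forall>v\<in>S. Suc v \<in> S \<or> 0 < v \<and> v - 1 \<in> S)"
  (is "?L \<longleftrightarrow> ?sub \<and> ?gap \<and> ?run")
proof (intro iffI conjI)
  assume L: ?L
  then show ?sub by (simp add: RED_LD_set_def LD_set_def)
  show ?gap
  proof (intro allI impI)
    fix v assume "v < n" "v \<notin> S"
    with RED_LD_set_imp_two_neighbours[OF L, of v]
    have "nbhd (path_graph n) v \<inter> S - {w} \<noteq> {}" for w by simp
    \<comment> \<open>Only \<open>v - 1\<close> and \<open>Suc v\<close> can be neighbours, so
      excluding either one forces the other.\<close>
    from this[of "Suc v"] this[of "v - 1"]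
    show "0 < v \<and> v - 1 \<in> S \<and> Suc v \<in> S" by (auto simp: in_nbhd_path_graph_iff)
  qed
  show ?run
  proof
    fix v assume "v \<in> S"
    from RED_LD_set_imp_neighbour[OF L this] show "Suc v \<in> S \<or> 0 < v \<and> v - 1 \<in> S"
      by (auto simp: in_nbhd_path_graph_iff)
  qed
next
  assume R: "?sub \<and> ?gap \<and> ?run"
  then have sub: "\<And>v. v \<in> S \<Longrightarrow> v < n"
    and gap: "\<And>v. v < n \<Longrightarrow> v \<notin> S \<Longrightarrow> 0 < v \<and> v - 1 \<in> S \<and> Suc v \<in> S"
    and run: "\<And>v. v \<in> S \<Longrightarrow> Suc v \<in> S \<or> 0 < v \<and> v - 1 \<in> S" by auto
  let ?N = "nbhd (path_graph n)"
  \<comment> \<open>\<open>X\<close> covers \<open>S\<close> itself and every deletion of one vertex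
    at once.\<close>
  have LD: "LD_set (path_graph n) (S - X)" if X: "X = {} \<or> X = {x}" for X x
  proof -
    have dom: "?N v \<inter> (S - X) \<noteq> {}" if v: "v < n" "v \<notin> S - X" for v
    proof (cases "v \<in> S")
      case True
      then have "X = {v}" using v X by auto
      with run[OF True] sub \<open>v < n\<close> show ?thesis
        by (force simp: in_nbhd_path_graph_iff)
    next
      case False
      with gap[of v] v have "0 < v" "v - 1 \<in> S" "Suc v \<in> S" by auto
      moreover from this have "v - 1 \<in> ?N v" "Suc v \<in> ?N v"
        using sub v by (auto simp: in_nbhd_path_graph_iff)
      moreover have "v - 1 \<notin> X \<or> Suc v \<notin> X" using X by auto
      ultimately show ?thesis by blast
    qed
    \<comment> \<open>Equal nonempty traces place \<open>u\<close> and \<open>v\<close> on the two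
      sides of a common neighbour \<open>w\<close>. As \<open>w\<close> has a neighbour in
      \<open>S\<close>, one of \<open>u\<close>, \<open>v\<close> is in \<open>S\<close> and hence
      is the deleted vertex. The other is then a gap of \<open>S\<close>, and its outer neighbour,
      not deleted, separates the two.\<close>
    have sep: False
      if uv: "u < n" "v < n" "u \<notin> S - X" "v \<notin> S - X" "u < v"
        and eq: "?N v \<inter> (S - X) = ?N u \<inter> (S - X)" for u v
    proof -
      obtain w where "w \<in> ?N v \<inter> (S - X)" using dom uv by blast
      with eq have w: "w \<in> S" "w \<in> ?N v" "w \<in> ?N u" by auto
      with \<open>u < v\<close> have v: "v = Suc w" and u: "w = Suc u"
        by (auto simp: in_nbhd_path_graph_iff)
      have vX: "Suc v \<in> X" if "Suc v \<in> S"
      proof (rule ccontr)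
        assume "Suc v \<notin> X"
        with that sub have "Suc v \<in> ?N v \<inter> (S - X)" using uv by (simp add: in_nbhd_path_graph_iff)
        with eq u v show False by (auto simp: in_nbhd_path_graph_iff)
      qed
      have uX: "u - 1 \<in> X" if "0 < u" "u - 1 \<in> S"
      proof (rule ccontr)
        assume "u - 1 \<notin> X"
        with that sub have "u - 1 \<in> ?N u \<inter> (S - X)" using uv by (simp add: in_nbhd_path_graph_iff)
        with eq have "u - 1 \<in> ?N v" by blast
        with u v show False by (auto simp: in_nbhd_path_graph_iff)
      qed
      have "u \<in> S \<or> v \<in> S" using run[OF w(1)] u v by auto
      then show False
      proof
        assume "u \<in> S"
        with uv X have "X = {u}" by auto
        then have "v \<notin> S" using uv by auto
        with gap[of v] uv vX \<open>X = {u}\<close> show False by auto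
      next
        assume "v \<in> S"
        with uv X have "X = {v}" by auto
        then have "u \<notin> S" using uv by auto
        with gap[of u] uv uX \<open>X = {v}\<close> show False by auto
      qed
    qed
    show ?thesis unfolding LD_set_def
    proof (intro conjI ballI impI)
      show "S - X \<subseteq> pverts (path_graph n)" using sub by auto
    next
      fix u v
      assume "u \<in> pverts (path_graph n) - (S - X)" "v \<in> pverts (path_graph n) - (S - X)"
      then have uv: "u < n" "v < n" "u \<notin> S - X" "v \<notin> S - X" by auto
      then show "?N v \<inter> (S - X) \<noteq> {}" using dom by blast
      assume "u \<noteq> v"
      then show "?N v \<inter> (S - X) \<noteq> ?N u \<inter> (S - X)"
        using sep[of u v] sep[of v u] uv by (metis nat_neq_iff)
    qed
  qed
  show ?L unfolding RED_LD_set_def using LD[of "{}"] LD[of "{_}"] by simp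
qed

lemma RED_LD_set_path_graph_card_ge:
  assumes S: "RED_LD_set (path_graph n) S"
  shows "n - (n - 2) div 3 \<le> card S"
proof -
  from S have sub: "S \<subseteq> {..<n}"
    and gap: "\<And>v. v < n \<Longrightarrow> v \<notin> S \<Longrightarrow> 0 < v \<and> v - 1 \<in> S \<and> Suc v \<in> S"
    and run: "\<And>v. v \<in> S \<Longrightarrow> Suc v \<in> S \<or> 0 < v \<and> v - 1 \<in> S"
    by (auto simp: RED_LD_set_path_graph_iff)
  define D where "D = {..<n} - S"
  \<comment> \<open>Since \<open>g\<close> is missing, the neighbour that \<open>Suc g\<close> has
    in \<open>S\<close> can only be \<open>Suc (Suc g)\<close>.\<close>
  have right: "Suc g \<in> S \<and> Suc (Suc g) \<in> S" if "g \<in> D" for g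
    using that gap[of g] run[of "Suc g"] by (auto simp: D_def)
  \<comment> \<open>A gap at \<open>1\<close> would isolate vertex \<open>0\<close> within
    \<open>S\<close>.\<close>
  have left: "2 \<le> g" if "g \<in> D" for g
    using that gap[of g] run[of "g - 1"] by (cases "g = 1") (auto simp: D_def)
  have far: "g + 3 \<le> h" if "g \<in> D" "h \<in> D" "g < h" for g h
  proof -
    have "h \<noteq> Suc g" "h \<noteq> Suc (Suc g)" using right[of g] that by (auto simp: D_def)
    with that show ?thesis by simp
  qed
  \<comment> \<open>Counting by blocks of three starting at \<open>2\<close>: gaps at distance at
    least \<open>3\<close> fall into different blocks.\<close>
  have "inj_on (\<lambda>g. (g - 2) div 3) D"
  proof (rule linorder_inj_onI')
    fix g h assume "g \<in> D" "h \<in> D" "g < h"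
    with far[of g h] left[of g] have "(g - 2) + 3 \<le> h - 2" by auto
    then have "((g - 2) + 3) div 3 \<le> (h - 2) div 3" by (rule div_le_mono)
    then show "(g - 2) div 3 \<noteq> (h - 2) div 3" by simp
  qed
  moreover have "(\<lambda>g. (g - 2) div 3) ` D \<subseteq> {..<(n - 2) div 3}"
  proof (rule image_subsetI)
    fix g assume "g \<in> D"
    with right[of g] left[of g] sub have "(g - 2) + 3 \<le> n - 2" by auto
    then have "((g - 2) + 3) div 3 \<le> (n - 2) div 3" by (rule div_le_mono)
    then show "(g - 2) div 3 \<in> {..<(n - 2) div 3}" by simp
  qed
  ultimately have "card D \<le> (n - 2) div 3"
    using card_inj_on_le[of _ D "{..<(n - 2) div 3}"] by simp
  moreover have "card D = n - card S"
    using sub by (simp add: D_def card_Diff_subset finite_subset)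
  ultimately show ?thesis by linarith
qed

lemma ex_RED_LD_set_path_graph_card:
  assumes "n \<ge> 2"
  shows "\<exists>S. RED_LD_set (path_graph n) S \<and> finite S \<and> card S = n - (n - 2) div 3"
proof -
  define D where "D = (\<lambda>k. 3 * k + 2) ` {..<(n - 2) div 3}"
  \<comment> \<open>The residue form reduces the neighbour conditions to \<open>mod_Suc\<close>; the
    bound \<open>g + 2 < n\<close> leaves room for two vertices to the right of each gap.\<close>
  have D_iff: "g \<in> D \<longleftrightarrow> g mod 3 = 2 \<and> g + 2 < n" for g
  proof
    assume "g \<in> D"
    then obtain k where k: "k < (n - 2) div 3" and g: "g = 3 * k + 2" unfolding D_def by blast
    have "g mod 3 = 2" unfolding g by (simp del: add_2_eq_Suc add_2_eq_Suc')
    moreover have "g + 2 < n" using k g by linarith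
    ultimately show "g mod 3 = 2 \<and> g + 2 < n" ..
  next
    assume g: "g mod 3 = 2 \<and> g + 2 < n"
    then obtain q where q: "g = 3 * q + 2" by (metis mult_div_mod_eq)
    have "Suc q * 3 \<le> n - 2" using conjunct2[OF g] unfolding q by simp
    then have "q < (n - 2) div 3"
      by (simp add: less_eq_div_iff_mult_less_eq flip: Suc_le_eq)
    with q show "g \<in> D" unfolding D_def by blast
  qed
  have "RED_LD_set (path_graph n) ({..<n} - D)"
    unfolding RED_LD_set_path_graph_iff
  proof (intro conjI allI ballI impI)
    fix v assume "v < n" "v \<notin> {..<n} - D"
    then have v: "v mod 3 = 2" "v + 2 < n" by (auto simp: D_iff)
    then obtain w where w: "v = Suc w" by (cases v) auto
    with v have "w mod 3 = 1" by (auto simp: mod_Suc split: if_splits)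
    with v w show "0 < v" "v - 1 \<in> {..<n} - D" "Suc v \<in> {..<n} - D"
      by (auto simp: D_iff mod_Suc)
  next
    fix v assume v: "v \<in> {..<n} - D"
    show "Suc v \<in> {..<n} - D \<or> 0 < v \<and> v - 1 \<in> {..<n} - D"
    proof (cases v)
      case 0
      \<comment> \<open>Vertex \<open>1\<close> exists because \<open>n \<ge> 2\<close>, and its
        residue keeps it out of \<open>D\<close>.\<close>
      with assms show ?thesis by (simp add: D_iff)
    next
      case (Suc w)
      \<comment> \<open>If \<open>w\<close> is a gap, \<open>Suc v\<close> is \<open>w + 2\<close>,
        which is below \<open>n\<close> and has residue \<open>1\<close>; otherwise \<open>w\<close>
        itself is the neighbour.\<close>
      with v show ?thesis by (auto simp: D_iff mod_Suc split: if_splits)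
    qed
  qed auto
  moreover have "card D = (n - 2) div 3"
    unfolding D_def by (subst card_image) (auto simp: inj_on_def)
  then have "card ({..<n} - D) = n - (n - 2) div 3"
    by (subst card_Diff_subset) (auto simp: D_iff D_def)
  ultimately show ?thesis by blast
qed

theorem theorem13:
  fixes n :: nat
  assumes "n \<ge> 2"
  shows "RED_LD (path_graph n) = enat (nat \<lceil>(2 * real n + 2) / 3\<rceil>)"
proof -
  have "\<lceil>(2 * real n + 2) / 3\<rceil> = int (n - (n - 2) div 3)"
  proof -
    define k where "k = (n - 2) div 3"
    \<comment> \<open>These two bounds are equivalent to \<open>(2 * n + 2) / 3 \<le> n - k\<close>
      and \<open>n - k - 1 < (2 * n + 2) / 3\<close>, which characterize the ceiling.\<close>
    have "3 * k + 2 \<le> n" "n \<le> 3 * k + 4" using assms unfolding k_def by linarith+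
    then have "\<lceil>(2 * real n + 2) / 3\<rceil> = int (n - k)"
      by (intro ceiling_unique) (auto simp: of_nat_diff)
    then show ?thesis by (simp add: k_def)
  qed
  then have "nat \<lceil>(2 * real n + 2) / 3\<rceil> = n - (n - 2) div 3" by simp
  then show ?thesis
    unfolding RED_LD_eq_enat_iff
    using ex_RED_LD_set_path_graph_card[OF assms] RED_LD_set_path_graph_card_ge by auto
qed

end
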